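(* Let $n>1$ be an integer, and let $G$ be a group which is finite or finitely generated solvable. Then $\mathrm{w}(G)=n$ if and only if $\mathrm{w}(G^{\mathrm{ab}})=n$; and $\mathrm{w}(G)\leq 1$ if and only if $\mathrm{w}(G^{\mathrm{ab}})\leq 1$.
   Context: The weight $\mathrm{w}(G)$ of a group $G$ is the smallest integer $n$ such that $G$ is the normal closure of $n$ of its elements, with $\mathrm{w}(\{e\}):=0$. $G^{\mathrm{ab}}=G/G'$ is the abelianisation of $G$. *)

theory Defs
  imports "HOL-Algebra.Solvable_Groups" "HOL-Library.Extended_Nat"
begin

definition normal_closure :: "('a, 'b) monoid_scheme \<Rightarrow> 'a set \<Rightarrow> 'a set" where
  "normal_closure G S = \<Inter>{N. N \<lhd> G \<and> S \<subseteq> N}"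

text \<open>
  The weight is \<open>\<infinity>\<close> (the infimum of the empty set) when no finite set normally generates the
  group. The value 0 for the trivial group is not a separate clause: it comes from the empty set,
  whose normal closure is the trivial subgroup, see \<open>weight_eq_0_iff\<close> below.
\<close>

definition weight :: "('a, 'b) monoid_scheme \<Rightarrow> enat" where
  "weight G = Inf {enat n |n. \<exists>S. S \<subseteq> carrier G \<and> finite S \<and> card S = n
                                  \<and> normal_closure G S = carrier G}"

definition abelianization :: "('a, 'b) monoid_scheme \<Rightarrow> 'a set monoid" where
  "abelianization G = G Mod (derived G (carrier G))"

definition finitely_generated :: "('a, 'b) monoid_scheme \<Rightarrow> bool" where
  "finitely_generated G \<longleftrightarrow> (\<exists>S. finite S \<and> S \<subseteq> carrier G \<and> generate G S = carrier G)"

lemma (in group) normal_closure_empty: "normal_closure G {} = {\<one>}"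
proof
  show "normal_closure G {} \<subseteq> {\<one>}"
    unfolding normal_closure_def using one_is_normal by blast
  show "{\<one>} \<subseteq> normal_closure G {}"
    unfolding normal_closure_def
    using subgroup.one_closed normal_imp_subgroup by blast
qed

lemma (in group) weight_eq_0_iff: "weight G = 0 \<longleftrightarrow> carrier G = {\<one>}"
proof -
  define A where "A = {enat n |n. \<exists>S. S \<subseteq> carrier G \<and> finite S \<and> card S = n
                             \<and> normal_closure G S = carrier G}"
  have w: "weight G = Inf A" by (simp add: weight_def A_def)
  show ?thesis
  proof
    assume "weight G = 0"
    then have Inf0: "Inf A = 0" by (simp add: w)
    then have ne: "A \<noteq> {}" by (metis Inf_enat_def i0_ne_infinity)
    then obtain a where a: "a \<in> A" by blast
    have "Inf A = (LEAST x. x \<in> A)" using ne by (simp add: Inf_enat_def)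
    also have "\<dots> \<in> A" by (rule LeastI[of "\<lambda>x. x \<in> A", OF a])
    finally have "Inf A \<in> A" .
    then have "0 \<in> A" using Inf0 by simp
    then have "normal_closure G {} = carrier G" by (auto simp: A_def zero_enat_def)
    then show "carrier G = {\<one>}" by (simp add: normal_closure_empty)
  next
    assume "carrier G = {\<one>}"
    then have "enat 0 \<in> A"
      unfolding A_def by (intro CollectI exI[of _ 0] conjI exI[of _ "{}"] refl)
        (simp_all add: normal_closure_empty)
    then have "Inf A \<le> enat 0" by (rule Inf_lower)
    then show "weight G = 0" by (simp add: w zero_enat_def[symmetric])
  qed
qed

end

theory Submission
  imports Defs
begin

text \<open>
  Both claims follow from the equivalence of \<open>weight G \<le> n\<close> and \<open>weight (abelianization G) \<le> n\<close> for
  all \<open>n \<ge> 1\<close> (lemma \<open>weight_abelianization_le_iff\<close>). Images of normal generators generate every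
  quotient, so the weight can only drop. Conversely, write \<open>G'\<close> for the derived subgroup. Lifts
  \<open>X\<close> of normal generators of \<open>G / G'\<close> satisfy only that \<open>X \<union> G'\<close> normally generates \<open>G\<close>, and the
  task is to get rid of \<open>G'\<close> without enlarging \<open>X\<close>.

  The tool is \<open>derived_subset_of_derived_set_subset\<close>: if \<open>N\<close> and \<open>L\<close> are normal, together generate
  \<open>G\<close>, and \<open>L\<close> is abelian modulo \<open>N\<close>, then \<open>G / N\<close> is a quotient of the abelian group
  \<open>L / (L \<inter> N)\<close>, so \<open>G' \<subseteq> N\<close>.

  If \<open>G\<close> is solvable, any lift works. Descending the derived series, suppose that \<open>X\<close> and
  \<open>G\<^bsup>(i)\<^esup>\<close> normally generate \<open>G\<close>, and let \<open>N\<close> be the normal closure of \<open>X\<close> and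
  \<open>G\<^bsup>(i+1)\<^esup>\<close>. Then \<open>G\<^bsup>(i)\<^esup>\<close> is abelian modulo \<open>N\<close>, so \<open>N\<close> contains \<open>G'\<close> as well
  as \<open>X\<close>, and \<open>N = G\<close>.

  If \<open>G\<close> is finite, one of the lifts, \<open>x\<close>, may have to be changed by an element of \<open>G'\<close>. Take a
  normal subgroup \<open>L \<subseteq> G'\<close> as small as possible such that some choice \<open>y = x c\<close> with \<open>c \<in> G'\<close> makes
  the lifts together with \<open>L\<close> normally generate \<open>G\<close>. Suppose that \<open>L \<noteq> 1\<close>, let \<open>K\<close> be maximal
  among the normal subgroups of \<open>G\<close> properly contained in \<open>L\<close>, and let \<open>P\<close> be the normal closure of
  the lifts and \<open>K\<close>. Then \<open>P \<inter> L = K\<close>, so \<open>P\<close> and \<open>L\<close> commute modulo \<open>K\<close>. If \<open>L / K\<close> were abelian,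
  the tool would give \<open>L \<subseteq> G' \<subseteq> P\<close>, a contradiction. Otherwise there are \<open>m, p \<in> L\<close> with
  \<open>[m, p] \<notin> K\<close>. Replace \<open>y\<close> by \<open>z = y m\<close>. Modulo \<open>K\<close>, the commutator \<open>[z, p]\<close> is \<open>[m, p]\<close>, so the
  normal closure of the new lifts and \<open>K\<close> meets \<open>L\<close> in more than \<open>K\<close>. By the maximality of \<open>K\<close> it
  contains \<open>L\<close>, hence also \<open>y = z m\<^sup>-\<^sup>1\<close>, and so it is \<open>G\<close>: now \<open>K\<close> contradicts the minimality of
  \<open>L\<close>.

  The bound \<open>n \<ge> 1\<close> enters because there must be a lift to change: a nontrivial finite perfect group
  has weight 1, whereas its abelianisation has weight 0.
\<close>

section \<open>Normal closures\<close>

context group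
begin

text \<open>
  With associativity and the rule for the inverse of a product, this lemma and the next one form a
  terminating rewrite system that reduces words in a group.
\<close>

lemma inv_mult_cancel_left:
  assumes "x \<in> carrier G" "y \<in> carrier G" shows "inv x \<otimes> (x \<otimes> y) = y"
  using assms by (simp flip: m_assoc)

lemma mult_inv_cancel_left:
  assumes "x \<in> carrier G" "y \<in> carrier G" shows "x \<otimes> (inv x \<otimes> y) = y"
  using assms by (simp flip: m_assoc)

lemma normal_closure_minimal:
  assumes "N \<lhd> G" "S \<subseteq> N" shows "normal_closure G S \<subseteq> N"
  using assms by (auto simp: normal_closure_def)

lemma normal_closure_incl: "S \<subseteq> normal_closure G S"
  by (auto simp: normal_closure_def)

lemma normal_closure_normal:
  assumes "S \<subseteq> carrier G" shows "normal_closure G S \<lhd> G"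
proof -
  have "carrier G \<in> {N. N \<lhd> G \<and> S \<subseteq> N}" using assms normal_self by blast
  then have "subgroup (normal_closure G S) G"
    unfolding normal_closure_def by (intro subgroups_Inter) (auto dest: normal_imp_subgroup)
  moreover have "g \<otimes> x \<otimes> inv g \<in> normal_closure G S"
    if "g \<in> carrier G" "x \<in> normal_closure G S" for g x
    using that by (auto simp: normal_closure_def normal_inv_iff)
  ultimately show ?thesis by (simp add: normal_inv_iff)
qed

text \<open>
  The form in which normal generation is used below: it speaks of normal subgroups only.
\<close>

lemma normal_closure_eq_carrier_iff:
  assumes "S \<subseteq> carrier G"
  shows "normal_closure G S = carrier G \<longleftrightarrow> (\<forall>N. N \<lhd> G \<longrightarrow> S \<subseteq> N \<longrightarrow> N = carrier G)"
proof
  assume "normal_closure G S = carrier G"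
  then show "\<forall>N. N \<lhd> G \<longrightarrow> S \<subseteq> N \<longrightarrow> N = carrier G"
    by (metis normal_closure_minimal normal_imp_subgroup subgroup.subset subset_antisym)
next
  assume "\<forall>N. N \<lhd> G \<longrightarrow> S \<subseteq> N \<longrightarrow> N = carrier G"
  then show "normal_closure G S = carrier G"
    using normal_closure_normal[OF assms] normal_closure_incl by blast
qed

lemma normal_closure_Un_one:
  "normal_closure G (S \<union> {\<one>}) = normal_closure G S"
proof -
  have "\<one> \<in> N" if "N \<lhd> G" for N
    using that normal_imp_subgroup subgroup.one_closed by blast
  then have "{N. N \<lhd> G \<and> S \<union> {\<one>} \<subseteq> N} = {N. N \<lhd> G \<and> S \<subseteq> N}" by auto
  then show ?thesis by (simp add: normal_closure_def)
qed

end

lemma (in group_hom) normal_vimage: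
  assumes "M \<lhd> H" shows "{g \<in> carrier G. h g \<in> M} \<lhd> G"
proof -
  interpret M: normal M H by fact
  have "subgroup {g \<in> carrier G. h g \<in> M} G"
    by (rule G.subgroupI) auto
  then show ?thesis
    by (auto simp: G.normal_inv_iff intro: M.inv_op_closed2)
qed

text \<open>
  Normal subgroups of the image correspond, by taking images and preimages, to normal subgroups of
  \<open>G\<close> that contain the kernel.
\<close>

lemma (in group_hom) normal_closure_image_eq_carrier_iff:
  assumes surj: "h ` carrier G = carrier H" and X: "X \<subseteq> carrier G"
  shows "normal_closure H (h ` X) = carrier H
    \<longleftrightarrow> normal_closure G (X \<union> kernel G H h) = carrier G"
proof -
  have K: "kernel G H h \<subseteq> carrier G" by (auto simp: kernel_def)
  have hX: "h ` X \<subseteq> carrier H" using X by auto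
  show ?thesis
  proof
    assume L: "normal_closure H (h ` X) = carrier H"
    have "N = carrier G" if N: "N \<lhd> G" and sub: "X \<union> kernel G H h \<subseteq> N" for N
    proof -
      interpret N: normal N G by fact
      have "h ` N \<lhd> H"
        using N.surj_hom_normal_subgroup[OF group_hom_axioms surj] .
      then have hN: "h ` N = carrier H"
        using L sub H.normal_closure_eq_carrier_iff[OF hX] by blast
      have "g \<in> N" if g: "g \<in> carrier G" for g
      proof -
        obtain m where m: "m \<in> N" "h g = h m"
          using hN g by (metis hom_closed imageE)
        then have mc: "m \<in> carrier G" by auto
        then have "g \<otimes>\<^bsub>G\<^esub> inv\<^bsub>G\<^esub> m \<in> kernel G H h" using m g by (auto simp: kernel_def)
        then have "g \<otimes>\<^bsub>G\<^esub> inv\<^bsub>G\<^esub> m \<otimes>\<^bsub>G\<^esub> m \<in> N" using sub m by blast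
        then show ?thesis using g mc by (simp add: G.m_assoc)
      qed
      then show ?thesis by auto
    qed
    then show "normal_closure G (X \<union> kernel G H h) = carrier G"
      using X K by (subst G.normal_closure_eq_carrier_iff) auto
  next
    assume L: "normal_closure G (X \<union> kernel G H h) = carrier G"
    have "M = carrier H" if M: "M \<lhd> H" and sub: "h ` X \<subseteq> M" for M
    proof -
      interpret M: normal M H by fact
      have "X \<union> kernel G H h \<subseteq> {g \<in> carrier G. h g \<in> M}"
        using sub X by (auto simp: kernel_def)
      then have "{g \<in> carrier G. h g \<in> M} = carrier G"
        using L normal_vimage[OF M] G.normal_closure_eq_carrier_iff[of "X \<union> kernel G H h"] X K
        by blast
      then have "h ` carrier G \<subseteq> M" by blast
      then show ?thesis using M.subset surj by blast
    qed
    then show "normal_closure H (h ` X) = carrier H"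
      by (subst H.normal_closure_eq_carrier_iff[OF hX]) auto
  qed
qed

section \<open>Commutators modulo a normal subgroup\<close>

context group
begin

lemma commutator_mem_Int_normal:
  assumes "M \<lhd> G" "N \<lhd> G" "a \<in> M" "b \<in> N"
  shows "a \<otimes> b \<otimes> inv a \<otimes> inv b \<in> M \<inter> N"
proof -
  interpret M: normal M G by fact
  interpret N: normal N G by fact
  have "a \<otimes> (b \<otimes> inv a \<otimes> inv b) \<in> M" using assms M.inv_op_closed2 by auto
  moreover have "a \<otimes> b \<otimes> inv a \<otimes> inv b \<in> N" using assms N.inv_op_closed2 by auto
  moreover have "a \<in> carrier G" "b \<in> carrier G" using assms by auto
  ultimately show ?thesis by (simp add: m_assoc)
qed

text \<open>
  For \<open>B\<close> normal in \<open>G\<close>, this is the preimage in \<open>G\<close> of the centralizer of the image of \<open>A\<close> in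
  \<open>G / B\<close>. Working with commutators in \<open>G\<close> avoids passing to the quotient group.
\<close>

definition centralizer_mod :: "'a set \<Rightarrow> 'a set \<Rightarrow> 'a set" where
  "centralizer_mod A B = {g \<in> carrier G. \<forall>a\<in>A. g \<otimes> a \<otimes> inv g \<otimes> inv a \<in> B}"

lemma normal_centralizer_mod:
  assumes "A \<lhd> G" "B \<lhd> G" shows "centralizer_mod A B \<lhd> G"
proof -
  interpret A: normal A G by fact
  interpret B: normal B G by fact
  have "subgroup (centralizer_mod A B) G"
  proof (rule subgroupI)
    show "centralizer_mod A B \<subseteq> carrier G" by (auto simp: centralizer_mod_def)
    have "\<one> \<in> centralizer_mod A B" by (auto simp: centralizer_mod_def)
    then show "centralizer_mod A B \<noteq> {}" by blast
  next
    fix g assume g: "g \<in> centralizer_mod A B"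
    then have gc: "g \<in> carrier G" by (simp add: centralizer_mod_def)
    \<comment> \<open>The commutator identity \<open>[g\<^sup>-\<^sup>1, a] = g\<^sup>-\<^sup>1 [g, a]\<^sup>-\<^sup>1 g\<close>.\<close>
    have "inv g \<otimes> a \<otimes> inv (inv g) \<otimes> inv a \<in> B" if a: "a \<in> A" for a
    proof -
      have "inv (g \<otimes> a \<otimes> inv g \<otimes> inv a) \<in> B" using g a by (auto simp: centralizer_mod_def)
      then have "inv g \<otimes> inv (g \<otimes> a \<otimes> inv g \<otimes> inv a) \<otimes> g \<in> B"
        using gc B.inv_op_closed1 by blast
      moreover have "a \<in> carrier G" using a by auto
      ultimately show ?thesis using gc by (simp add: inv_mult_group m_assoc inv_mult_cancel_left mult_inv_cancel_left)
    qed
    then show "inv g \<in> centralizer_mod A B" using gc by (simp add: centralizer_mod_def)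
  next
    fix g k assume g: "g \<in> centralizer_mod A B" and k: "k \<in> centralizer_mod A B"
    have gc: "g \<in> carrier G" and kc: "k \<in> carrier G" using g k by (auto simp: centralizer_mod_def)
    \<comment> \<open>The commutator identity \<open>[g k, a] = (g [k, a] g\<^sup>-\<^sup>1) [g, a]\<close>.\<close>
    have "g \<otimes> k \<otimes> a \<otimes> inv (g \<otimes> k) \<otimes> inv a \<in> B" if a: "a \<in> A" for a
    proof -
      have "g \<otimes> (k \<otimes> a \<otimes> inv k \<otimes> inv a) \<otimes> inv g \<in> B"
        using k a gc by (auto simp: centralizer_mod_def B.inv_op_closed2)
      moreover have "g \<otimes> a \<otimes> inv g \<otimes> inv a \<in> B" using g a by (auto simp: centralizer_mod_def)
      ultimately have "(g \<otimes> (k \<otimes> a \<otimes> inv k \<otimes> inv a) \<otimes> inv g) \<otimes> (g \<otimes> a \<otimes> inv g \<otimes> inv a) \<in> B"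
        by blast
      moreover have "a \<in> carrier G" using a by auto
      ultimately show ?thesis using gc kc by (simp add: inv_mult_group m_assoc inv_mult_cancel_left mult_inv_cancel_left)
    qed
    then show "g \<otimes> k \<in> centralizer_mod A B" using gc kc by (simp add: centralizer_mod_def)
  qed
  moreover have "x \<otimes> g \<otimes> inv x \<in> centralizer_mod A B"
    if x: "x \<in> carrier G" and g: "g \<in> centralizer_mod A B" for x g
  proof -
    have gc: "g \<in> carrier G" using g by (simp add: centralizer_mod_def)
    \<comment> \<open>The commutator identity \<open>[x g x\<^sup>-\<^sup>1, a] = x [g, x\<^sup>-\<^sup>1 a x] x\<^sup>-\<^sup>1\<close>.\<close>
    have "x \<otimes> g \<otimes> inv x \<otimes> a \<otimes> inv (x \<otimes> g \<otimes> inv x) \<otimes> inv a \<in> B" if a: "a \<in> A" for a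
    proof -
      have ac: "a \<in> carrier G" using a by auto
      have "inv x \<otimes> a \<otimes> x \<in> A" using x a A.inv_op_closed1 by blast
      then have "g \<otimes> (inv x \<otimes> a \<otimes> x) \<otimes> inv g \<otimes> inv (inv x \<otimes> a \<otimes> x) \<in> B"
        using g by (simp add: centralizer_mod_def)
      then have "x \<otimes> (g \<otimes> (inv x \<otimes> a \<otimes> x) \<otimes> inv g \<otimes> inv (inv x \<otimes> a \<otimes> x)) \<otimes> inv x \<in> B"
        using x B.inv_op_closed2 by blast
      then show ?thesis using gc ac x by (simp add: inv_mult_group m_assoc)
    qed
    then show ?thesis using x gc by (simp add: centralizer_mod_def)
  qed
  ultimately show ?thesis by (simp add: normal_inv_iff)
qed

text \<open>
  Modulo \<open>N\<close>, the group is generated by the abelian subgroup \<open>L\<close>, hence abelian. In terms of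
  centralizers modulo \<open>N\<close>: the one of \<open>L\<close> contains \<open>L\<close> and \<open>N\<close>, so it is everything; therefore
  the one of \<open>G\<close> contains \<open>L\<close> and \<open>N\<close>, and it is everything too.
\<close>

lemma derived_subset_of_derived_set_subset:
  assumes L: "L \<lhd> G" and N: "N \<lhd> G" and XN: "X \<subseteq> N"
    and gen: "normal_closure G (X \<union> L) = carrier G" and ab: "derived_set G L \<subseteq> N"
  shows "derived G (carrier G) \<subseteq> N"
proof -
  interpret L: normal L G by fact
  interpret N: normal N G by fact
  have XL: "X \<union> L \<subseteq> carrier G" using XN L.subset N.subset by blast
  have gen': "M = carrier G" if "M \<lhd> G" "X \<subseteq> M" "L \<subseteq> M" for M
    using that gen normal_closure_eq_carrier_iff[OF XL] by blast
  have N_le: "N \<subseteq> centralizer_mod A N" if "A \<lhd> G" for A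
    using commutator_mem_Int_normal[OF N that] by (auto simp: centralizer_mod_def)
  have "L \<subseteq> centralizer_mod L N" using ab by (auto simp: centralizer_mod_def)
  then have CL: "centralizer_mod L N = carrier G"
    using gen'[OF normal_centralizer_mod[OF L N]] N_le[OF L] XN by blast
  have "L \<subseteq> centralizer_mod (carrier G) N"
  proof
    fix l assume l: "l \<in> L"
    have "l \<otimes> g \<otimes> inv l \<otimes> inv g \<in> N" if g: "g \<in> carrier G" for g
    proof -
      have "g \<otimes> l \<otimes> inv g \<otimes> inv l \<in> N" using CL g l by (auto simp: centralizer_mod_def)
      then have "inv (g \<otimes> l \<otimes> inv g \<otimes> inv l) \<in> N" by blast
      moreover have "l \<in> carrier G" using l by auto
      ultimately show ?thesis using g by (simp add: inv_mult_group m_assoc)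
    qed
    then show "l \<in> centralizer_mod (carrier G) N" using l by (auto simp: centralizer_mod_def)
  qed
  then have "centralizer_mod (carrier G) N = carrier G"
    using gen'[OF normal_centralizer_mod[OF normal_self N]] N_le[OF normal_self] XN by blast
  then have "derived_set G (carrier G) \<subseteq> N" by (auto simp: centralizer_mod_def)
  then show ?thesis unfolding derived_def
    by (rule generate_subgroup_incl) (rule N.subgroup_axioms)
qed

section \<open>Lifting normal generators from the abelianisation\<close>

text \<open>
  Equivalently, a solvable group \<open>G / N\<close> that is perfect is trivial. The induction replaces \<open>G'\<close> by
  ever later terms of the derived series.
\<close>

lemma solvable_normal_closure_eq_carrier:
  assumes solv: "solvable G" and X: "X \<subseteq> carrier G"
    and gen: "normal_closure G (X \<union> derived G (carrier G)) = carrier G"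
  shows "normal_closure G X = carrier G"
proof -
  have Dn: "(derived G ^^ i) (carrier G) \<lhd> G" for i
    by (induction i) (simp_all add: normal_self derived_is_normal)
  have XD: "X \<union> (derived G ^^ i) (carrier G) \<subseteq> carrier G" for i
    using X Dn[of i] normal_imp_subgroup subgroup.subset by blast
  have "normal_closure G (X \<union> (derived G ^^ i) (carrier G)) = carrier G" for i
  proof (induction i)
    case 0
    show ?case
      using normal_closure_eq_carrier_iff[of "X \<union> carrier G"] X normal_imp_subgroup
      by (auto dest!: subgroup.subset)
  next
    case (Suc i)
    define N where "N = normal_closure G (X \<union> (derived G ^^ Suc i) (carrier G))"
    have N: "N \<lhd> G" unfolding N_def by (rule normal_closure_normal[OF XD])
    have sub: "X \<union> (derived G ^^ Suc i) (carrier G) \<subseteq> N"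
      unfolding N_def by (rule normal_closure_incl)
    have "derived_set G ((derived G ^^ i) (carrier G)) \<subseteq> derived G ((derived G ^^ i) (carrier G))"
      unfolding derived_def by (rule subsetI) (rule generate.incl)
    then have "derived G (carrier G) \<subseteq> N"
      using derived_subset_of_derived_set_subset[OF Dn N _ Suc.IH] sub by auto
    then have "X \<union> derived G (carrier G) \<subseteq> N" using sub by blast
    then have "carrier G \<subseteq> N" using normal_closure_minimal[OF N] gen by blast
    then show ?case using N normal_imp_subgroup subgroup.subset unfolding N_def by blast
  qed
  moreover obtain n where "(derived G ^^ n) (carrier G) = {\<one>}"
    using solv solvable_iff_trivial_derived_seq by blast
  ultimately show ?thesis by (metis normal_closure_Un_one)
qed

text \<open>
  A nonabelian chief factor \<open>L / K\<close> inside \<open>G'\<close> can be absorbed by multiplying \<open>x\<close> by a single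
  element of \<open>L\<close> that is not central in \<open>L\<close> modulo \<open>K\<close>, and an abelian one needs no correction.
  Finiteness of \<open>G'\<close> provides both the minimal \<open>L\<close> to which this is applied and the maximal \<open>K\<close>
  below it.
\<close>

lemma finite_derived_adjust_normal_generator:
  assumes fin: "finite (derived G (carrier G))"
    and x: "x \<in> carrier G" and T: "T \<subseteq> carrier G"
    and gen: "normal_closure G (insert x T \<union> derived G (carrier G)) = carrier G"
  shows "\<exists>c \<in> derived G (carrier G). normal_closure G (insert (x \<otimes> c) T) = carrier G"
proof -
  define D where "D = derived G (carrier G)"
  have D: "D \<lhd> G" unfolding D_def by (rule derived_self_is_normal)
  interpret D: normal D G by (rule D)
  define good where "good L \<longleftrightarrow> (\<exists>c\<in>D. normal_closure G (insert (x \<otimes> c) T \<union> L) = carrier G)" for L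
  define \<A> where "\<A> = {L. L \<lhd> G \<and> L \<subseteq> D \<and> good L}"
  have "good D" unfolding good_def
    using gen x by (intro bexI[of _ \<one>]) (auto simp: D_def[symmetric])
  then have "D \<in> \<A>" using D by (simp add: \<A>_def)
  moreover have "finite \<A>"
    by (rule finite_subset[of _ "Pow D"]) (auto simp: \<A>_def D_def fin)
  ultimately obtain L where LA: "L \<in> \<A>" and Lmin: "\<And>K. K \<in> \<A> \<Longrightarrow> K \<subseteq> L \<Longrightarrow> K = L"
    using finite_has_minimal[of \<A>] by (metis empty_iff)
  have L: "L \<lhd> G" and LD: "L \<subseteq> D" using LA by (auto simp: \<A>_def)
  interpret L: normal L G by (rule L)
  obtain c where c: "c \<in> D" and genL: "normal_closure G (insert (x \<otimes> c) T \<union> L) = carrier G"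
    using LA by (auto simp: \<A>_def good_def)
  define y where "y = x \<otimes> c"
  have yc: "y \<in> carrier G" using x c by (simp add: y_def)
  have genL': "M = carrier G" if "M \<lhd> G" "y \<in> M" "T \<subseteq> M" "L \<subseteq> M" for M
    using that genL normal_closure_eq_carrier_iff[of "insert y T \<union> L"] yc T L.subset
    by (auto simp: y_def)
  have "L = {\<one>}"
  proof (rule ccontr)
    assume L1: "L \<noteq> {\<one>}"
    define \<B> where "\<B> = {K. K \<lhd> G \<and> K \<subset> L}"
    have "{\<one>} \<in> \<B>" using L1 one_is_normal L.one_closed by (auto simp: \<B>_def)
    moreover have "finite \<B>"
      by (rule finite_subset[of _ "Pow D"]) (use LD in \<open>auto simp: \<B>_def D_def fin\<close>)
    ultimately obtain K where KB: "K \<in> \<B>" and Kmax: "\<And>M. M \<in> \<B> \<Longrightarrow> K \<subseteq> M \<Longrightarrow> K = M"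
      using finite_has_maximal[of \<B>] by (metis empty_iff)
    have K: "K \<lhd> G" and KL: "K \<subset> L" using KB by (auto simp: \<B>_def)
    interpret K: normal K G by (rule K)
    have chief: "P \<inter> L = K \<or> L \<subseteq> P" if P: "P \<lhd> G" and KP: "K \<subseteq> P" for P
      using Kmax[of "P \<inter> L"] normal_subgroup_intersect[OF P L] KP KL by (auto simp: \<B>_def)
    have notgood: "\<not> good K" using Lmin[of K] K KL LD by (auto simp: \<A>_def)
    define P where "P = normal_closure G (insert y T \<union> K)"
    have ycl: "insert y T \<union> K \<subseteq> carrier G" using yc T K.subset by auto
    have P: "P \<lhd> G" unfolding P_def by (rule normal_closure_normal[OF ycl])
    have Psub: "insert y T \<union> K \<subseteq> P" unfolding P_def by (rule normal_closure_incl)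
    have PnG: "P \<noteq> carrier G" using notgood c by (auto simp: good_def P_def y_def)
    have nLP: "\<not> L \<subseteq> P" using genL'[OF P] Psub PnG by blast
    then have PL: "P \<inter> L = K" using chief[OF P] Psub by blast
    have "\<not> derived_set G L \<subseteq> P"
    proof
      assume "derived_set G L \<subseteq> P"
      then have "D \<subseteq> P"
        unfolding D_def
        using derived_subset_of_derived_set_subset[OF L P, of "insert y T"] Psub genL
        by (auto simp: y_def)
      then show False using LD nLP by blast
    qed
    then obtain m p where m: "m \<in> L" and p: "p \<in> L" and mp: "m \<otimes> p \<otimes> inv m \<otimes> inv p \<notin> P"
      by blast
    have mc: "m \<in> carrier G" and pc: "p \<in> carrier G" using m p by auto
    define z where "z = y \<otimes> m"
    have zc: "z \<in> carrier G" using yc mc by (simp add: z_def)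
    \<comment> \<open>Since \<open>y\<close> commutes with \<open>p\<close> modulo \<open>K\<close>, the identity \<open>[y m, p] = (y [m, p] y\<^sup>-\<^sup>1) [y, p]\<close>
      shows that \<open>[z, p]\<close> is a conjugate of \<open>[m, p]\<close> modulo \<open>K\<close>.\<close>
    have zcomm: "z \<otimes> p \<otimes> inv z \<otimes> inv p \<notin> K"
    proof
      assume "z \<otimes> p \<otimes> inv z \<otimes> inv p \<in> K"
      moreover have "y \<otimes> p \<otimes> inv y \<otimes> inv p \<in> K"
        using commutator_mem_Int_normal[OF P L, of y p] Psub p PL by auto
      ultimately have
        "inv y \<otimes> ((z \<otimes> p \<otimes> inv z \<otimes> inv p) \<otimes> inv (y \<otimes> p \<otimes> inv y \<otimes> inv p)) \<otimes> y \<in> K"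
        using yc by (blast intro: K.inv_op_closed1)
      then have "m \<otimes> p \<otimes> inv m \<otimes> inv p \<in> K"
        using yc mc pc by (simp add: z_def inv_mult_group m_assoc inv_mult_cancel_left mult_inv_cancel_left)
      then show False using mp Psub by blast
    qed
    define P' where "P' = normal_closure G (insert z T \<union> K)"
    have zcl: "insert z T \<union> K \<subseteq> carrier G" using zc T K.subset by auto
    have P': "P' \<lhd> G" unfolding P'_def by (rule normal_closure_normal[OF zcl])
    interpret P': normal P' G by (rule P')
    have P'sub: "insert z T \<union> K \<subseteq> P'" unfolding P'_def by (rule normal_closure_incl)
    have "z \<otimes> p \<otimes> inv z \<otimes> inv p \<in> P' \<inter> L"
      using commutator_mem_Int_normal[OF P' L] P'sub p by blast
    then have LP': "L \<subseteq> P'" using chief[OF P'] P'sub zcomm by blast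
    then have "z \<otimes> inv m \<in> P'" using m P'sub by blast
    then have "y \<in> P'" using yc mc by (simp add: z_def m_assoc)
    then have "P' = carrier G" using genL'[OF P'] P'sub LP' by blast
    moreover have "z = x \<otimes> (c \<otimes> m)" using x c mc by (simp add: z_def y_def m_assoc)
    moreover have "c \<otimes> m \<in> D" using c m LD by blast
    ultimately have "good K" by (auto simp: good_def P'_def)
    then show False using notgood by simp
  qed
  then show ?thesis using genL c normal_closure_Un_one unfolding D_def by metis
qed

end

section \<open>Weight\<close>

lemma weight_le_enat_iff:
  "weight G \<le> enat n \<longleftrightarrow>
    (\<exists>S. S \<subseteq> carrier G \<and> finite S \<and> card S \<le> n \<and> normal_closure G S = carrier G)"
proof -
  define A where "A = {enat n |n. \<exists>S. S \<subseteq> carrier G \<and> finite S \<and> card S = n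
                             \<and> normal_closure G S = carrier G}"
  have w: "weight G = Inf A" by (simp add: weight_def A_def)
  show ?thesis
  proof
    assume le: "weight G \<le> enat n"
    then have "A \<noteq> {}" unfolding w Inf_enat_def by (auto split: if_splits)
    then have "Inf A \<in> A" unfolding Inf_enat_def by (auto intro: LeastI)
    then show "\<exists>S. S \<subseteq> carrier G \<and> finite S \<and> card S \<le> n \<and> normal_closure G S = carrier G"
      using le unfolding w[symmetric] by (auto simp: A_def)
  next
    assume "\<exists>S. S \<subseteq> carrier G \<and> finite S \<and> card S \<le> n \<and> normal_closure G S = carrier G"
    then obtain S where S: "S \<subseteq> carrier G" "finite S" "card S \<le> n" "normal_closure G S = carrier G"
      by blast
    then have "enat (card S) \<in> A" by (auto simp: A_def)
    then have "Inf A \<le> enat (card S)" by (rule Inf_lower)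
    also have "\<dots> \<le> enat n" using S by simp
    finally show "weight G \<le> enat n" by (simp add: w)
  qed
qed

text \<open>
  The hypothesis \<open>n \<ge> 1\<close> leaves room for one lift \<open>x\<close> that may be changed by an element of \<open>G'\<close>.
\<close>

lemma (in group) weight_abelianization_le_iff:
  assumes n: "n \<ge> 1" and G: "finite (derived G (carrier G)) \<or> solvable G"
  shows "weight (abelianization G) \<le> enat n \<longleftrightarrow> weight G \<le> enat n"
proof -
  define D where "D = derived G (carrier G)"
  have D: "D \<lhd> G" unfolding D_def by (rule derived_self_is_normal)
  interpret D: normal D G by (rule D)
  define h where "h = (\<lambda>a. D #> a)"
  have H: "abelianization G = G Mod D" by (simp add: abelianization_def D_def)
  interpret h: group_hom G "G Mod D" h
    unfolding group_hom_def group_hom_axioms_def h_def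
    using is_group D.factorgroup_is_group D.r_coset_hom_Mod by simp
  have surj: "h ` carrier G = carrier (G Mod D)" by (simp add: carrier_FactGroup h_def)
  have ker: "kernel G (G Mod D) h = D"
  proof -
    have "h a = D \<longleftrightarrow> a \<in> D" if "a \<in> carrier G" for a
      unfolding h_def
      using coset_join1[OF _ that D.subgroup_axioms] coset_join2[OF that D.subgroup_axioms] by blast
    then show ?thesis using D.subset by (auto simp: kernel_def)
  qed
  have gen_iff: "normal_closure (G Mod D) (h ` X) = carrier (G Mod D)
      \<longleftrightarrow> normal_closure G (X \<union> D) = carrier G" if "X \<subseteq> carrier G" for X
    using h.normal_closure_image_eq_carrier_iff[OF surj that] by (simp add: ker)
  show ?thesis
  proof
    assume "weight (abelianization G) \<le> enat n"
    then obtain S where S: "S \<subseteq> carrier (G Mod D)" "finite S" "card S \<le> n"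
      "normal_closure (G Mod D) S = carrier (G Mod D)"
      unfolding H weight_le_enat_iff by blast
    obtain X0 where X0: "X0 \<subseteq> carrier G" "finite X0" "card X0 \<le> n" "S = h ` X0"
    proof -
      obtain U where U: "U \<subseteq> carrier G" "inj_on h U" "S = h ` U"
        using S(1) subset_image_inj[of S h "carrier G"] unfolding surj by blast
      then have "finite U" "card U = card S" using S(2) by (auto simp: card_image dest: finite_imageD)
      then show thesis using that U S(3) by simp
    qed
    obtain x T where xT: "x \<in> carrier G" "T \<subseteq> carrier G" "finite T" "card T < n"
      and gen: "normal_closure G (insert x T \<union> D) = carrier G"
    proof (cases "X0 = {}")
      case True
      \<comment> \<open>If the abelianisation is trivial, the identity serves as the lift to be changed.\<close>
      then have "normal_closure G ({} \<union> D) = carrier G" using gen_iff[OF X0(1)] S(4) X0(4) by simp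
      then have "normal_closure G (insert \<one> {} \<union> D) = carrier G"
        using normal_closure_Un_one[of D] by (simp add: insert_absorb)
      then show thesis using that[of \<one> "{}"] n by simp
    next
      case False
      then obtain x where x: "x \<in> X0" by blast
      then have "card (X0 - {x}) < n" using X0 by (meson card_Diff1_less order_less_le_trans)
      moreover have "normal_closure G (X0 \<union> D) = carrier G" using gen_iff[OF X0(1)] S(4) X0(4) by simp
      ultimately show thesis using that[of x "X0 - {x}"] X0 x by (auto simp: insert_absorb)
    qed
    have "\<exists>c \<in> D. normal_closure G (insert (x \<otimes> c) T) = carrier G"
    proof (cases "solvable G")
      case True
      then have "normal_closure G (insert (x \<otimes> \<one>) T) = carrier G"
        using solvable_normal_closure_eq_carrier[OF True, of "insert x T"] gen xT
        by (auto simp: D_def)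
      then show ?thesis using D.one_closed by blast
    next
      case False
      then show ?thesis
        using finite_derived_adjust_normal_generator[of x T] gen xT G by (auto simp: D_def)
    qed
    then obtain c where "c \<in> D" "normal_closure G (insert (x \<otimes> c) T) = carrier G" by blast
    moreover have "card (insert (x \<otimes> c) T) \<le> n" using xT by (simp add: card_insert_if)
    ultimately show "weight G \<le> enat n"
      unfolding weight_le_enat_iff using xT
      by (intro exI[of _ "insert (x \<otimes> c) T"]) auto
  next
    assume "weight G \<le> enat n"
    then obtain S where S: "S \<subseteq> carrier G" "finite S" "card S \<le> n" "normal_closure G S = carrier G"
      unfolding weight_le_enat_iff by blast
    have SD: "S \<union> D \<subseteq> carrier G" using S D.subset by blast
    have "normal_closure G (S \<union> D) = carrier G"
      using S normal_closure_eq_carrier_iff[OF SD] normal_closure_eq_carrier_iff[OF S(1)] by blast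
    then have "normal_closure (G Mod D) (h ` S) = carrier (G Mod D)" using gen_iff S by blast
    moreover have "card (h ` S) \<le> n" using S by (meson card_image_le order_trans)
    moreover have "h ` S \<subseteq> carrier (G Mod D)" using S surj by blast
    ultimately show "weight (abelianization G) \<le> enat n"
      unfolding H weight_le_enat_iff using S by blast
  qed
qed

theorem corollary5p17:
  fixes G :: "('a, 'b) monoid_scheme" and n :: nat
  assumes "n > 1"
    and "group G"
    and "finite (carrier G) \<or> (finitely_generated G \<and> solvable G)"
  shows "(weight G = enat n \<longleftrightarrow> weight (abelianization G) = enat n)
       \<and> (weight G \<le> 1 \<longleftrightarrow> weight (abelianization G) \<le> 1)"
proof -
  interpret group G by fact
  have "finite (derived G (carrier G)) \<or> solvable G"
    using assms(3) derived_in_carrier[of "carrier G"] finite_subset by blast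
  then have le: "weight (abelianization G) \<le> enat k \<longleftrightarrow> weight G \<le> enat k" if "k \<ge> 1" for k
    using weight_abelianization_le_iff that by blast
  \<comment> \<open>Since \<open>n - 1 \<ge> 1\<close>, the equivalence of the bounds applies to both \<open>n\<close> and \<open>n - 1\<close>.\<close>
  have eq: "w = enat n \<longleftrightarrow> w \<le> enat n \<and> \<not> w \<le> enat (n - 1)" for w
    using assms(1) by (cases w) auto
  show ?thesis
    using le[of n] le[of "n - 1"] le[of 1] assms(1)
    by (simp add: eq one_enat_def)
qed

end
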